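(* Let $p\ge 3$ be a prime and let $a,b\in\mathcal{E}_p$. Suppose that the function $$g_{a,b}(u)=a\left(\frac{b^2u^2+1}{b^2+u^2}\right)$$ has three fixed points $x_0,x_1,x_2$ in $\mathbb{Q}_p$, where $x_0$ denotes the fixed point lying in $\mathcal{E}_p$. Then: (i) $x_0$ is an attracting fixed point of $g_{a,b}$; (ii) $x_1$ and $x_2$ are repelling fixed points of $g_{a,b}$.
   Context: $\mathbb{Q}_p$ is the field of $p$-adic numbers with the $p$-adic absolute value $|\cdot|_p$ normalized by $|p|_p=1/p$. $\mathcal{E}_p=\{x\in\mathbb{Q}_p:\ |x-1|_p<1\}$. A fixed point of $g_{a,b}$ is an $x\in\mathbb{Q}_p$ with $b^2+x^2\neq 0$ and $g_{a,b}(x)=x$. Throughout, $x_0$ denotes the unique fixed point of $g_{a,b}$ in $\mathcal{E}_p$, and $x_1,x_2$ denote the two other fixed points (which lie in $\mathbb{Q}_p\setminus\mathcal{E}_p$). For a fixed point $x^*$ of $g_{a,b}$ put $\lambda=g_{a,b}'(x^* )$; the point $x^*$ is called attracting if $0\le|\lambda|_p<1$, indifferent if $|\lambda|_p=1$, and repelling if $|\lambda|_p>1$. *)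

theory Defs
  imports Complex_Main "Berlekamp_Zassenhaus.Finite_Field"
begin

section \<open>The p-adic absolute value on the rationals\<close>

definition padic_val_rat :: "nat \<Rightarrow> rat \<Rightarrow> int" where
  "padic_val_rat p r =
     int (multiplicity (int p) (fst (quotient_of r)))
   - int (multiplicity (int p) (snd (quotient_of r)))"

definition padic_abs_rat :: "nat \<Rightarrow> rat \<Rightarrow> real" where
  "padic_abs_rat p r = (if r = 0 then 0 else real p powi (- padic_val_rat p r))"

lemma padic_val_rat_divide:
  assumes p: "prime p" and m: "m \<noteq> 0" and n: "n \<noteq> 0"
  shows "padic_val_rat p (of_int m / of_int n) =
    int (multiplicity (int p) m) - int (multiplicity (int p) n)"
proof -
  have pe: "prime_elem (int p)" using p by simp
  obtain u v where uv: "quotient_of (of_int m / of_int n) = (u, v)"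
    by (cases "quotient_of (of_int m / of_int n)")
  have v: "v > 0" using uv by (rule quotient_of_denom_pos)
  have eq: "of_int m / of_int n = (of_int u / of_int v :: rat)"
    using uv by (rule quotient_of_div)
  have "(of_int m * of_int v :: rat) = of_int u * of_int n"
    using eq n v by (simp add: field_simps)
  then have e: "m * v = u * n" by (metis of_int_eq_iff of_int_mult)
  have u: "u \<noteq> 0" using e m v by auto
  have "multiplicity (int p) (m * v) = multiplicity (int p) (u * n)" using e by simp
  then have "multiplicity (int p) m + multiplicity (int p) v
    = multiplicity (int p) u + multiplicity (int p) n"
    using pe m n u v by (simp add: prime_elem_multiplicity_mult_distrib)
  then show ?thesis using uv by (simp add: padic_val_rat_def)
qed

lemma rat_as_quotient:
  fixes r :: rat
  obtains m n where "r = of_int m / of_int n" "n \<noteq> 0"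
  by (metis quotient_of_denom_pos quotient_of_div surj_pair less_irrefl)

lemma padic_abs_rat_0 [simp]: "padic_abs_rat p 0 = 0"
  by (simp add: padic_abs_rat_def)

lemma padic_abs_rat_nonneg [simp]: "padic_abs_rat p r \<ge> 0"
  by (simp add: padic_abs_rat_def)

lemma padic_abs_rat_eq_0_iff: "prime p \<Longrightarrow> padic_abs_rat p r = 0 \<longleftrightarrow> r = 0"
  by (auto simp: padic_abs_rat_def prime_gt_0_nat)

lemma padic_abs_rat_mult:
  assumes p: "prime p"
  shows "padic_abs_rat p (x * y) = padic_abs_rat p x * padic_abs_rat p y"
proof (cases "x = 0 \<or> y = 0")
  case False
  obtain m n where x: "x = of_int m / of_int n" "n \<noteq> 0" by (rule rat_as_quotient)
  obtain k l where y: "y = of_int k / of_int l" "l \<noteq> 0" by (rule rat_as_quotient)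
  have mk: "m \<noteq> 0" "k \<noteq> 0" using False x y by auto
  have pe: "prime_elem (int p)" using p by simp
  have xy: "x * y = of_int (m * k) / of_int (n * l)" using x y by simp
  have "padic_val_rat p (x * y) = padic_val_rat p x + padic_val_rat p y"
    using x y mk pe padic_val_rat_divide[OF p mk(1) x(2)] padic_val_rat_divide[OF p mk(2) y(2)]
      padic_val_rat_divide[OF p, of "m * k" "n * l"] xy
    by (simp add: prime_elem_multiplicity_mult_distrib)
  then have "- padic_val_rat p (x * y) = - padic_val_rat p x + - padic_val_rat p y" by simp
  moreover have "real p \<noteq> 0" using p by (simp add: prime_gt_0_nat)
  ultimately have "real p powi (- padic_val_rat p (x * y))
    = real p powi (- padic_val_rat p x) * real p powi (- padic_val_rat p y)"
    by (metis power_int_add)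
  then show ?thesis using False by (simp add: padic_abs_rat_def)
qed auto

lemma padic_abs_rat_1 [simp]: "padic_abs_rat p 1 = 1"
  by (simp add: padic_abs_rat_def padic_val_rat_def)

lemma padic_abs_rat_minus [simp]: "padic_abs_rat p (- x) = padic_abs_rat p x"
proof -
  have "multiplicity (int p) (- m) = multiplicity (int p) m" for m
    by (metis abs_minus multiplicity_normalize_right normalize_int_def)
  then show ?thesis
    by (auto simp: padic_abs_rat_def padic_val_rat_def rat_uminus_code Let_def split: prod.splits)
qed

lemma padic_abs_rat_inverse:
  assumes p: "prime p"
  shows "padic_abs_rat p (inverse x) = inverse (padic_abs_rat p x)"
proof (cases "x = 0")
  case False
  then have "padic_abs_rat p (inverse x) * padic_abs_rat p x = 1"
    using padic_abs_rat_mult[OF p, of "inverse x" x] by simp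
  then show ?thesis by (metis inverse_unique mult.commute)
qed simp

lemma padic_abs_rat_add_max:
  assumes p: "prime p"
  shows "padic_abs_rat p (x + y) \<le> max (padic_abs_rat p x) (padic_abs_rat p y)"
proof (cases "x = 0 \<or> y = 0 \<or> x + y = 0")
  case True
  then show ?thesis by (auto simp: le_max_iff_disj)
next
  case False
  obtain m n where x: "x = of_int m / of_int n" "n \<noteq> 0" by (rule rat_as_quotient)
  obtain k l where y: "y = of_int k / of_int l" "l \<noteq> 0" by (rule rat_as_quotient)
  define M K d where "M = m * l" and "K = k * n" and "d = n * l"
  have d: "d \<noteq> 0" using x y by (simp add: d_def)
  have x': "x = of_int M / of_int d" and y': "y = of_int K / of_int d"
    using x y by (auto simp: M_def K_def d_def)
  have xy': "x + y = of_int (M + K) / of_int d" by (simp add: x' y' add_divide_distrib)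
  have nz: "M \<noteq> 0" "K \<noteq> 0" "M + K \<noteq> 0" using False x' y' xy' by auto
  have pe: "prime_elem (int p)" using p by simp
  define t where "t = min (multiplicity (int p) M) (multiplicity (int p) K)"
  have "int p ^ t dvd M" "int p ^ t dvd K" by (auto simp: t_def intro: multiplicity_dvd')
  then have "int p ^ t dvd M + K" by simp
  then have "t \<le> multiplicity (int p) (M + K)"
    using nz pe by (intro multiplicity_geI) (auto simp: prime_elem_def)
  then have "padic_val_rat p (x + y) \<ge> min (padic_val_rat p x) (padic_val_rat p y)"
    unfolding xy' unfolding x' y' padic_val_rat_divide[OF p nz(3) d]
      padic_val_rat_divide[OF p nz(1) d] padic_val_rat_divide[OF p nz(2) d] t_def by linarith
  then have "- padic_val_rat p (x + y) \<le> - padic_val_rat p x \<or> - padic_val_rat p (x + y) \<le> - padic_val_rat p y"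
    by linarith
  moreover have "real p \<ge> 1" using prime_ge_1_nat[OF p] by simp
  ultimately have "real p powi (- padic_val_rat p (x + y)) \<le> real p powi (- padic_val_rat p x)
    \<or> real p powi (- padic_val_rat p (x + y)) \<le> real p powi (- padic_val_rat p y)"
    using power_int_increasing by blast
  then show ?thesis using False by (simp add: padic_abs_rat_def le_max_iff_disj)
qed

lemma padic_abs_rat_triangle:
  assumes p: "prime p"
  shows "padic_abs_rat p (x + y) \<le> padic_abs_rat p x + padic_abs_rat p y"
  using padic_abs_rat_add_max[OF p, of x y] padic_abs_rat_nonneg[of p x] padic_abs_rat_nonneg[of p y]
  by linarith

lemma padic_abs_rat_diff_abs:
  assumes p: "prime p"
  shows "\<bar>padic_abs_rat p x - padic_abs_rat p y\<bar> \<le> padic_abs_rat p (x - y)"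
  using padic_abs_rat_triangle[OF p, of "x - y" y] padic_abs_rat_triangle[OF p, of "y - x" x]
    padic_abs_rat_minus[of p "x - y"] by simp

lemma padic_abs_rat_self:
  assumes p: "prime p"
  shows "padic_abs_rat p (of_nat p) = 1 / real p"
proof -
  have pe: "prime_elem (int p)" using p by simp
  have p0: "int p \<noteq> 0" using p by (simp add: prime_gt_0_nat)
  have "padic_val_rat p (of_int (int p) / of_int 1) = 1"
    using padic_val_rat_divide[OF p p0, of 1] multiplicity_prime[OF pe] by simp
  then show ?thesis using p by (simp add: padic_abs_rat_def prime_gt_0_nat power_int_minus field_simps)
qed


section \<open>The field of p-adic numbers\<close>

text \<open>
  The p-adic numbers are the completion of the rationals with respect to the p-adic absolute value:
  p-adically Cauchy sequences of rationals modulo p-adic null sequences. The prime enters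
  through a type parameter of class \<^class>\<open>prime_card\<close>, namely as its cardinality.
\<close>

definition padic_cauchy :: "nat \<Rightarrow> (nat \<Rightarrow> rat) \<Rightarrow> bool" where
  "padic_cauchy p X \<longleftrightarrow>
     (\<forall>e>0. \<exists>N. \<forall>m\<ge>N. \<forall>n\<ge>N. padic_abs_rat p (X m - X n) < e)"

typedef (overloaded) ('p::prime_card) padic_seq = "{X. padic_cauchy CARD('p) X}"
  morphisms padic_seq_nth Abs_padic_seq
  by (intro exI[of _ "\<lambda>_. 0"]) (simp add: padic_cauchy_def)

setup_lifting type_definition_padic_seq

lemma padic_cauchy_add:
  assumes p: "prime p" and "padic_cauchy p X" "padic_cauchy p Y"
  shows "padic_cauchy p (\<lambda>n. X n + Y n)"
  unfolding padic_cauchy_def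
proof (intro allI impI)
  fix e :: real assume "e > 0"
  obtain N where N: "\<And>m n. m \<ge> N \<Longrightarrow> n \<ge> N \<Longrightarrow> padic_abs_rat p (X m - X n) < e"
    using assms(2) \<open>e > 0\<close> unfolding padic_cauchy_def by blast
  obtain M where M: "\<And>m n. m \<ge> M \<Longrightarrow> n \<ge> M \<Longrightarrow> padic_abs_rat p (Y m - Y n) < e"
    using assms(3) \<open>e > 0\<close> unfolding padic_cauchy_def by blast
  have "padic_abs_rat p (X m + Y m - (X n + Y n)) < e" if "m \<ge> max M N" "n \<ge> max M N" for m n
  proof -
    have eq: "X m + Y m - (X n + Y n) = (X m - X n) + (Y m - Y n)" by simp
    show ?thesis unfolding eq
      using padic_abs_rat_add_max[OF p, of "X m - X n" "Y m - Y n"] N[of m n] M[of m n] that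
      by simp
  qed
  then show "\<exists>N. \<forall>m\<ge>N. \<forall>n\<ge>N. padic_abs_rat p (X m + Y m - (X n + Y n)) < e" by blast
qed

lemma padic_cauchy_minus:
  assumes "padic_cauchy p X"
  shows "padic_cauchy p (\<lambda>n. - X n)"
proof -
  have "padic_abs_rat p (- X m - - X n) = padic_abs_rat p (X m - X n)" for m n
    using padic_abs_rat_minus[of p "X m - X n"] by simp
  then show ?thesis using assms unfolding padic_cauchy_def by simp
qed

lemma padic_cauchy_convergent:
  assumes p: "prime p" and X: "padic_cauchy p X"
  shows "convergent (\<lambda>n. padic_abs_rat p (X n))"
proof -
  have "Cauchy (\<lambda>n. padic_abs_rat p (X n))"
    unfolding Cauchy_def dist_real_def
    using X padic_abs_rat_diff_abs[OF p] unfolding padic_cauchy_def by (meson order_le_less_trans)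
  then show ?thesis by (simp add: Cauchy_convergent_iff)
qed

lemma padic_cauchy_bounded:
  assumes p: "prime p" and X: "padic_cauchy p X"
  obtains B where "B > 0" "\<And>n. padic_abs_rat p (X n) \<le> B"
proof -
  have "Bseq (\<lambda>n. padic_abs_rat p (X n))"
    using padic_cauchy_convergent[OF p X] by (rule convergent_imp_Bseq)
  then show ?thesis using that by (auto simp: Bseq_def)
qed

lemma padic_cauchy_mult:
  assumes p: "prime p" and X: "padic_cauchy p X" and Y: "padic_cauchy p Y"
  shows "padic_cauchy p (\<lambda>n. X n * Y n)"
  unfolding padic_cauchy_def
proof (intro allI impI)
  fix e :: real assume "e > 0"
  obtain B where B: "B > 0" "\<And>n. padic_abs_rat p (X n) \<le> B" using p X by (rule padic_cauchy_bounded) blast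
  obtain C where C: "C > 0" "\<And>n. padic_abs_rat p (Y n) \<le> C" using p Y by (rule padic_cauchy_bounded) blast
  have "e / C > 0" "e / B > 0" using \<open>e > 0\<close> B C by auto
  obtain N where N: "\<And>m n. m \<ge> N \<Longrightarrow> n \<ge> N \<Longrightarrow> padic_abs_rat p (X m - X n) < e / C"
    using X \<open>e / C > 0\<close> unfolding padic_cauchy_def by blast
  obtain M where M: "\<And>m n. m \<ge> M \<Longrightarrow> n \<ge> M \<Longrightarrow> padic_abs_rat p (Y m - Y n) < e / B"
    using Y \<open>e / B > 0\<close> unfolding padic_cauchy_def by blast
  have "padic_abs_rat p (X m * Y m - X n * Y n) < e" if mn: "m \<ge> max M N" "n \<ge> max M N" for m n
  proof -
    have eq: "X m * Y m - X n * Y n = X m * (Y m - Y n) + (X m - X n) * Y n"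
      by (simp add: algebra_simps)
    have "padic_abs_rat p (X m) * padic_abs_rat p (Y m - Y n) \<le> B * padic_abs_rat p (Y m - Y n)"
      using B by (intro mult_right_mono) auto
    also have "\<dots> < B * (e / B)"
      using B M[of m n] mn by (intro mult_strict_left_mono) auto
    finally have "padic_abs_rat p (X m * (Y m - Y n)) < B * (e / B)"
      by (simp add: padic_abs_rat_mult[OF p])
    then have 1: "padic_abs_rat p (X m * (Y m - Y n)) < e" using B by simp
    have "padic_abs_rat p (X m - X n) * padic_abs_rat p (Y n) \<le> padic_abs_rat p (X m - X n) * C"
      using C by (intro mult_left_mono) auto
    also have "\<dots> < (e / C) * C"
      using C N[of m n] mn by (intro mult_strict_right_mono) auto
    finally have "padic_abs_rat p ((X m - X n) * Y n) < (e / C) * C"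
      by (simp add: padic_abs_rat_mult[OF p])
    then have 2: "padic_abs_rat p ((X m - X n) * Y n) < e" using C by simp
    show ?thesis unfolding eq
      using padic_abs_rat_add_max[OF p, of "X m * (Y m - Y n)" "(X m - X n) * Y n"] 1 2 by simp
  qed
  then show "\<exists>N. \<forall>m\<ge>N. \<forall>n\<ge>N. padic_abs_rat p (X m * Y m - X n * Y n) < e" by blast
qed

lemma padic_cauchy_const: "padic_cauchy p (\<lambda>_. c)"
  by (simp add: padic_cauchy_def)

lemma padic_cauchy_inverse:
  assumes p: "prime p" and X: "padic_cauchy p X"
    and nn: "\<not> (\<lambda>n. padic_abs_rat p (X n)) \<longlonglongrightarrow> 0"
  shows "padic_cauchy p (\<lambda>n. inverse (X n))"
proof -
  obtain L where L: "(\<lambda>n. padic_abs_rat p (X n)) \<longlonglongrightarrow> L"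
    using padic_cauchy_convergent[OF p X] by (auto simp: convergent_def)
  have "L \<ge> 0" using L by (rule LIMSEQ_le_const) simp
  with nn L have "L > 0" by (cases "L = 0") auto
  define c where "c = L / 2"
  have c: "c > 0" "c < L" using \<open>L > 0\<close> by (auto simp: c_def)
  have "\<forall>\<^sub>F n in sequentially. c < padic_abs_rat p (X n)"
    using order_tendstoD(1)[OF L c(2)] .
  then obtain K where K: "\<And>n. n \<ge> K \<Longrightarrow> c < padic_abs_rat p (X n)"
    by (auto simp: eventually_sequentially)
  show ?thesis unfolding padic_cauchy_def
  proof (intro allI impI)
    fix e :: real assume "e > 0"
    then have "e * (c * c) > 0" using c by simp
    then obtain N where N: "\<And>m n. m \<ge> N \<Longrightarrow> n \<ge> N \<Longrightarrow> padic_abs_rat p (X m - X n) < e * (c * c)"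
      using X unfolding padic_cauchy_def by blast
    have "padic_abs_rat p (inverse (X m) - inverse (X n)) < e" if mn: "m \<ge> max K N" "n \<ge> max K N" for m n
    proof -
      have am: "c < padic_abs_rat p (X m)" "c < padic_abs_rat p (X n)" using K mn by auto
      then have nz: "X m \<noteq> 0" "X n \<noteq> 0" using c by auto
      have cc: "c * c < padic_abs_rat p (X m) * padic_abs_rat p (X n)"
        using am c by (intro mult_strict_mono) auto
      have "inverse (X m) - inverse (X n) = - (X m - X n) * inverse (X m * X n)"
        using nz by (simp add: field_simps)
      then have "padic_abs_rat p (inverse (X m) - inverse (X n))
        = padic_abs_rat p (X m - X n) * inverse (padic_abs_rat p (X m) * padic_abs_rat p (X n))"
        by (simp only: padic_abs_rat_mult[OF p] padic_abs_rat_inverse[OF p] padic_abs_rat_minus)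
      also have "\<dots> \<le> padic_abs_rat p (X m - X n) * inverse (c * c)"
        using cc c by (intro mult_left_mono le_imp_inverse_le) auto
      also have "\<dots> < e * (c * c) * inverse (c * c)"
        using N[of m n] mn c by (intro mult_strict_right_mono) auto
      also have "\<dots> = e" using c by (simp add: field_simps)
      finally show ?thesis .
    qed
    then show "\<exists>N. \<forall>m\<ge>N. \<forall>n\<ge>N. padic_abs_rat p (inverse (X m) - inverse (X n)) < e" by blast
  qed
qed

instantiation padic_seq :: (prime_card) comm_ring_1
begin

lift_definition zero_padic_seq :: "'a padic_seq" is "\<lambda>_. 0"
  by (rule padic_cauchy_const)

lift_definition one_padic_seq :: "'a padic_seq" is "\<lambda>_. 1"
  by (rule padic_cauchy_const)

lift_definition plus_padic_seq :: "'a padic_seq \<Rightarrow> 'a padic_seq \<Rightarrow> 'a padic_seq"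
  is "\<lambda>X Y n. X n + Y n"
  by (rule padic_cauchy_add[OF prime_card])

lift_definition uminus_padic_seq :: "'a padic_seq \<Rightarrow> 'a padic_seq" is "\<lambda>X n. - X n"
  by (rule padic_cauchy_minus)

lift_definition times_padic_seq :: "'a padic_seq \<Rightarrow> 'a padic_seq \<Rightarrow> 'a padic_seq"
  is "\<lambda>X Y n. X n * Y n"
  by (rule padic_cauchy_mult[OF prime_card])

definition minus_padic_seq :: "'a padic_seq \<Rightarrow> 'a padic_seq \<Rightarrow> 'a padic_seq" where
  "minus_padic_seq X Y = X + - Y"

instance
proof
  fix a b c :: "'a padic_seq"
  show "a + b = b + a" by transfer (simp add: ac_simps)
  show "(a + b) + c = a + (b + c)" by transfer (simp add: ac_simps)
  show "0 + a = a" by transfer simp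
  show "- a + a = 0" by transfer simp
  show "a - b = a + - b" by (rule minus_padic_seq_def)
  show "(a * b) * c = a * (b * c)" by transfer (simp add: ac_simps)
  show "a * b = b * a" by transfer (simp add: ac_simps)
  show "1 * a = a" by transfer simp
  show "(a + b) * c = a * c + b * c" by transfer (simp add: distrib_right)
  show "(0::'a padic_seq) \<noteq> 1" by transfer (simp add: fun_eq_iff)
qed

end

lift_definition padic_seq_inverse :: "'p::prime_card padic_seq \<Rightarrow> 'p padic_seq"
  is "\<lambda>X. if (\<lambda>n. padic_abs_rat CARD('p) (X n)) \<longlonglongrightarrow> 0 then (\<lambda>_. 0) else (\<lambda>n. inverse (X n))"
  by (auto intro: padic_cauchy_const padic_cauchy_inverse[OF prime_card])

definition padic_seq_null :: "'p::prime_card padic_seq \<Rightarrow> bool" where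
  "padic_seq_null X \<longleftrightarrow> (\<lambda>n. padic_abs_rat CARD('p) (padic_seq_nth X n)) \<longlonglongrightarrow> 0"

definition padic_seq_norm :: "'p::prime_card padic_seq \<Rightarrow> real" where
  "padic_seq_norm X = lim (\<lambda>n. padic_abs_rat CARD('p) (padic_seq_nth X n))"

lemma padic_seq_norm_lim:
  fixes X :: "'p::prime_card padic_seq"
  shows "(\<lambda>n. padic_abs_rat CARD('p) (padic_seq_nth X n)) \<longlonglongrightarrow> padic_seq_norm X"
  unfolding padic_seq_norm_def
  using padic_cauchy_convergent[OF prime_card[where 'a='p], of "padic_seq_nth X"] padic_seq_nth[of X]
  by (simp add: convergent_LIMSEQ_iff)

lemma padic_seq_null_iff: "padic_seq_null X \<longleftrightarrow> padic_seq_norm X = 0"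
  using padic_seq_norm_lim[of X] LIMSEQ_unique unfolding padic_seq_null_def by auto

lemma padic_seq_norm_nonneg: "padic_seq_norm X \<ge> 0"
  using padic_seq_norm_lim[of X] by (rule LIMSEQ_le_const) simp

lemma padic_seq_norm_mult: "padic_seq_norm (X * Y) = padic_seq_norm X * padic_seq_norm Y"
  for X Y :: "'p::prime_card padic_seq"
  using padic_seq_norm_lim[of "X * Y"] tendsto_mult[OF padic_seq_norm_lim[of X] padic_seq_norm_lim[of Y]]
  by (simp add: times_padic_seq.rep_eq padic_abs_rat_mult[OF prime_card] LIMSEQ_unique)

lemma padic_seq_norm_minus: "padic_seq_norm (- X) = padic_seq_norm X"
  unfolding padic_seq_norm_def by (simp add: uminus_padic_seq.rep_eq)

lemma padic_seq_norm_minus_commute: "padic_seq_norm (X - Y) = padic_seq_norm (Y - X)"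
  using padic_seq_norm_minus[of "X - Y"] by simp

lemma padic_seq_norm_add_max:
  fixes X Y :: "'p::prime_card padic_seq"
  shows "padic_seq_norm (X + Y) \<le> max (padic_seq_norm X) (padic_seq_norm Y)"
  using padic_seq_norm_lim[of "X + Y"] tendsto_max[OF padic_seq_norm_lim[of X] padic_seq_norm_lim[of Y]]
  by (rule LIMSEQ_le) (auto simp: plus_padic_seq.rep_eq intro!: exI[of _ 0] padic_abs_rat_add_max[OF prime_card])

lemma padic_seq_norm_const:
  assumes "padic_seq_nth X = (\<lambda>_. c)"
  shows "padic_seq_norm (X :: 'p::prime_card padic_seq) = padic_abs_rat CARD('p) c"
  using assms unfolding padic_seq_norm_def by simp

lemma padic_seq_norm_0: "padic_seq_norm 0 = 0"
  by (subst padic_seq_norm_const[of _ 0]) (auto simp: zero_padic_seq.rep_eq)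

lemma padic_seq_norm_1: "padic_seq_norm 1 = 1"
  by (subst padic_seq_norm_const[of _ 1]) (auto simp: one_padic_seq.rep_eq)

lemma padic_seq_norm_diff_0_trans:
  assumes "padic_seq_norm (X - Y) = 0" "padic_seq_norm (Y - Z) = 0"
  shows "padic_seq_norm (X - Z) = 0"
  using padic_seq_norm_add_max[of "X - Y" "Y - Z"] assms padic_seq_norm_nonneg[of "X - Z"] by simp

lemma padic_seq_norm_cong:
  assumes "padic_seq_norm (X - Y) = 0"
  shows "padic_seq_norm X = padic_seq_norm Y"
proof -
  have "padic_seq_norm X \<le> padic_seq_norm Y" if "padic_seq_norm (X - Y) = 0"
    for X Y :: "'a padic_seq"
    using padic_seq_norm_add_max[of "X - Y" Y] that padic_seq_norm_nonneg[of Y] by simp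
  then show ?thesis using assms padic_seq_norm_minus_commute[of X Y] by (metis order_antisym)
qed

lemma padic_seq_inverse_mult:
  fixes X :: "'p::prime_card padic_seq"
  assumes nz: "padic_seq_norm X \<noteq> 0"
  shows "padic_seq_norm (padic_seq_inverse X * X - 1) = 0"
proof -
  have "\<forall>\<^sub>F n in sequentially. padic_abs_rat CARD('p) (padic_seq_nth X n) \<noteq> 0"
    using padic_seq_norm_lim[of X] nz by (rule tendsto_imp_eventually_ne)
  then have ev: "\<forall>\<^sub>F n in sequentially. padic_seq_nth X n \<noteq> 0"
    by (rule eventually_mono) auto
  have nn: "\<not> (\<lambda>n. padic_abs_rat CARD('p) (padic_seq_nth X n)) \<longlonglongrightarrow> 0"
    using nz padic_seq_null_iff[of X] by (simp add: padic_seq_null_def)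
  have "\<forall>\<^sub>F n in sequentially.
      padic_abs_rat CARD('p) (padic_seq_nth (padic_seq_inverse X * X - 1) n) = 0"
    using ev
  proof (rule eventually_mono)
    fix n assume "padic_seq_nth X n \<noteq> 0"
    moreover have "padic_seq_nth (padic_seq_inverse X * X - 1) n
      = inverse (padic_seq_nth X n) * padic_seq_nth X n + - 1"
      using nn unfolding minus_padic_seq_def plus_padic_seq.rep_eq times_padic_seq.rep_eq
        uminus_padic_seq.rep_eq one_padic_seq.rep_eq padic_seq_inverse.rep_eq by simp
    ultimately show "padic_abs_rat CARD('p) (padic_seq_nth (padic_seq_inverse X * X - 1) n) = 0"
      by simp
  qed
  then have "(\<lambda>n. padic_abs_rat CARD('p) (padic_seq_nth (padic_seq_inverse X * X - 1) n)) \<longlonglongrightarrow> 0"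
    by (rule tendsto_eventually)
  then show ?thesis using padic_seq_null_iff unfolding padic_seq_null_def by blast
qed

lemma padic_seq_inverse_cong:
  fixes X Y :: "'p::prime_card padic_seq"
  assumes XY: "padic_seq_norm (X - Y) = 0"
  shows "padic_seq_norm (padic_seq_inverse X - padic_seq_inverse Y) = 0"
proof (cases "padic_seq_norm X = 0")
  case True
  then have "padic_seq_null X" "padic_seq_null Y"
    using padic_seq_norm_cong[OF XY] by (auto simp: padic_seq_null_iff)
  then have "padic_seq_inverse X = 0" "padic_seq_inverse Y = 0"
    by (auto simp: padic_seq_null_def padic_seq_nth_inject[symmetric]
        padic_seq_inverse.rep_eq zero_padic_seq.rep_eq)
  then show ?thesis by (simp add: padic_seq_norm_0)
next
  case False
  let ?I = "padic_seq_inverse X" and ?J = "padic_seq_inverse Y"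
  have nY: "padic_seq_norm Y \<noteq> 0" using False padic_seq_norm_cong[OF XY] by simp
  have "?I - ?J = (?I * X - 1) * ?J + (- (?I * (?J * Y - 1)) + - (?I * ?J * (X - Y)))"
    by (simp add: algebra_simps)
  also have "padic_seq_norm \<dots> \<le> 0"
    using padic_seq_inverse_mult[OF False] padic_seq_inverse_mult[OF nY] XY
    by (intro order_trans[OF padic_seq_norm_add_max] max.boundedI)
      (simp_all only: padic_seq_norm_mult padic_seq_norm_minus mult_zero_left mult_zero_right order_refl)
  finally show ?thesis using padic_seq_norm_nonneg[of "?I - ?J"] by linarith
qed

definition padic_rel :: "'p::prime_card padic_seq \<Rightarrow> 'p padic_seq \<Rightarrow> bool" where
  "padic_rel X Y \<longleftrightarrow> padic_seq_null (X - Y)"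

lemma padic_rel_iff: "padic_rel X Y \<longleftrightarrow> padic_seq_norm (X - Y) = 0"
  by (simp add: padic_rel_def padic_seq_null_iff)

lemma padic_rel_refl: "padic_rel X X"
  by (simp add: padic_rel_iff padic_seq_norm_0)

quotient_type (overloaded) 'p padic = "'p::prime_card padic_seq" / padic_rel
proof (rule equivpI)
  show "reflp padic_rel" by (auto intro: reflpI padic_rel_refl)
  show "symp padic_rel" by (rule sympI) (metis padic_rel_iff padic_seq_norm_minus_commute)
  show "transp padic_rel"
    by (rule transpI) (metis padic_rel_iff padic_seq_norm_diff_0_trans)
qed

instantiation padic :: (prime_card) field
begin

lift_definition zero_padic :: "'a padic" is 0 .

lift_definition one_padic :: "'a padic" is 1 .

lift_definition plus_padic :: "'a padic \<Rightarrow> 'a padic \<Rightarrow> 'a padic" is "(+)"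
proof -
  fix X X' Y Y' :: "'a padic_seq"
  assume "padic_rel X X'" "padic_rel Y Y'"
  then show "padic_rel (X + Y) (X' + Y')"
    using padic_seq_norm_add_max[of "X - X'" "Y - Y'"] padic_seq_norm_nonneg[of "X + Y - (X' + Y')"]
    by (simp add: padic_rel_iff add_diff_add)
qed

lift_definition uminus_padic :: "'a padic \<Rightarrow> 'a padic" is "uminus"
  by (metis padic_rel_iff padic_seq_norm_minus_commute minus_diff_minus padic_seq_norm_minus)

lift_definition times_padic :: "'a padic \<Rightarrow> 'a padic \<Rightarrow> 'a padic" is "(*)"
proof -
  fix X X' Y Y' :: "'a padic_seq"
  assume a: "padic_rel X X'" "padic_rel Y Y'"
  have "X * Y - X' * Y' = X * (Y - Y') + (X - X') * Y'" by (simp add: algebra_simps)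
  then show "padic_rel (X * Y) (X' * Y')"
    using a padic_seq_norm_add_max[of "X * (Y - Y')" "(X - X') * Y'"]
      padic_seq_norm_nonneg[of "X * Y - X' * Y'"]
    by (simp add: padic_rel_iff padic_seq_norm_mult)
qed

lift_definition inverse_padic :: "'a padic \<Rightarrow> 'a padic" is padic_seq_inverse
  by (simp add: padic_rel_iff padic_seq_inverse_cong)

definition minus_padic :: "'a padic \<Rightarrow> 'a padic \<Rightarrow> 'a padic" where
  "minus_padic x y = x + - y"

definition divide_padic :: "'a padic \<Rightarrow> 'a padic \<Rightarrow> 'a padic" where
  "divide_padic x y = x * inverse y"

instance
proof
  fix a b c :: "'a padic"
  show "a + b = b + a" by transfer (metis add.commute padic_rel_refl)
  show "(a + b) + c = a + (b + c)" by transfer (metis add.assoc padic_rel_refl)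
  show "0 + a = a" by transfer (simp add: padic_rel_refl)
  show "- a + a = 0" by transfer (simp add: padic_rel_refl)
  show "a - b = a + - b" by (rule minus_padic_def)
  show "(a * b) * c = a * (b * c)" by transfer (metis mult.assoc padic_rel_refl)
  show "a * b = b * a" by transfer (metis mult.commute padic_rel_refl)
  show "1 * a = a" by transfer (simp add: padic_rel_refl)
  show "(a + b) * c = a * c + b * c" by transfer (metis distrib_right padic_rel_refl)
  show "(0::'a padic) \<noteq> 1"
    by transfer (simp add: padic_rel_iff padic_seq_norm_minus padic_seq_norm_1)
  show "a \<noteq> 0 \<Longrightarrow> inverse a * a = 1"
    by transfer (simp add: padic_rel_iff padic_seq_inverse_mult)
  show "a div b = a * inverse b" by (rule divide_padic_def)
  have "padic_seq_inverse (0 :: 'a padic_seq) = 0"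
    by (simp add: padic_seq_nth_inject[symmetric] padic_seq_inverse.rep_eq zero_padic_seq.rep_eq)
  then show "inverse (0::'a padic) = 0" by transfer (simp add: padic_rel_refl)
qed

end


section \<open>The p-adic absolute value and its topology\<close>

text \<open>
  The library constant \<^const>\<open>norm\<close> is constrained to real vector spaces, so the p-adic absolute
  value, the limit of the absolute values along any representing Cauchy sequence, gets its own name.
\<close>

lift_definition padic_norm :: "'p::prime_card padic \<Rightarrow> real" is padic_seq_norm
  by (simp add: padic_rel_iff padic_seq_norm_cong)

instantiation padic :: (prime_card) metric_space
begin

definition dist_padic :: "'a padic \<Rightarrow> 'a padic \<Rightarrow> real" where
  "dist_padic x y = padic_norm (x - y)"

definition uniformity_padic :: "('a padic \<times> 'a padic) filter" where
  "uniformity_padic = (INF e\<in>{0<..}. principal {(x, y). dist x y < e})"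

definition open_padic :: "'a padic set \<Rightarrow> bool" where
  "open_padic U \<longleftrightarrow> (\<forall>x\<in>U. \<forall>\<^sub>F (x', y) in uniformity. x' = x \<longrightarrow> y \<in> U)"

instance
proof
  fix x y z :: "'a padic" and U :: "'a padic set"
  show "uniformity = (INF e\<in>{0<..}. principal {(x :: 'a padic, y). dist x y < e})"
    by (rule uniformity_padic_def)
  show "open U \<longleftrightarrow> (\<forall>x\<in>U. \<forall>\<^sub>F (x', y) in uniformity. x' = x \<longrightarrow> y \<in> U)"
    by (rule open_padic_def)
  have *: "padic_norm (u + v) \<le> max (padic_norm u) (padic_norm v)" for u v :: "'a padic"
    by transfer (rule padic_seq_norm_add_max)
  have **: "padic_norm u \<ge> 0" for u :: "'a padic" by transfer (rule padic_seq_norm_nonneg)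
  have ***: "padic_norm (- u) = padic_norm u" for u :: "'a padic" by transfer (rule padic_seq_norm_minus)
  have "padic_norm u = 0 \<longleftrightarrow> u = 0" for u :: "'a padic"
    by transfer (simp add: padic_rel_iff)
  then show "dist x y = 0 \<longleftrightarrow> x = y" by (simp add: dist_padic_def)
  have "x - y = (x - z) + - (y - z)" by simp
  then show "dist x y \<le> dist x z + dist y z"
    using *[of "x - z" "- (y - z)"] **[of "x - z"] **[of "y - z"] ***[of "y - z"]
    unfolding dist_padic_def by simp
qed

end

lemma padic_norm_add_max: "padic_norm (x + y) \<le> max (padic_norm x) (padic_norm y)" for x y :: "'p::prime_card padic"
  by transfer (rule padic_seq_norm_add_max)

lemma padic_norm_mult: "padic_norm (x * y) = padic_norm x * padic_norm y" for x y :: "'p::prime_card padic"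
  by transfer (rule padic_seq_norm_mult)

lemma padic_norm_nonneg: "padic_norm x \<ge> 0" for x :: "'p::prime_card padic"
  by transfer (rule padic_seq_norm_nonneg)

lemma padic_norm_minus: "padic_norm (- x) = padic_norm x" for x :: "'p::prime_card padic"
  by transfer (rule padic_seq_norm_minus)

lemma padic_norm_eq_0_iff: "padic_norm x = 0 \<longleftrightarrow> x = 0" for x :: "'p::prime_card padic"
  by transfer (simp add: padic_rel_iff)

lemma padic_norm_1: "padic_norm (1 :: 'p::prime_card padic) = 1"
  by transfer (rule padic_seq_norm_1)

lemma padic_norm_of_nat: "padic_norm (of_nat n :: 'p::prime_card padic) = padic_abs_rat CARD('p) (of_nat n)"
proof -
  have eq: "(of_nat n :: 'p padic) = abs_padic (of_nat n)"
    by (induction n) (simp_all add: zero_padic.abs_eq one_padic.abs_eq plus_padic.abs_eq)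
  have "padic_seq_nth (of_nat n :: 'p padic_seq) = (\<lambda>_. of_nat n)"
    by (induction n) (simp_all add: zero_padic_seq.rep_eq one_padic_seq.rep_eq plus_padic_seq.rep_eq)
  then show ?thesis unfolding eq by (simp add: padic_norm.abs_eq padic_seq_norm_const)
qed

lemma padic_norm_prime: "padic_norm (of_nat CARD('p) :: 'p::prime_card padic) = 1 / real CARD('p)"
  by (simp add: padic_norm_of_nat padic_abs_rat_self[OF prime_card])

instance padic :: (prime_card) field_char_0
proof
  show "inj (of_nat :: nat \<Rightarrow> 'a padic)"
  proof (rule linorder_injI)
    fix m n :: nat assume "m < n"
    then have "(of_nat (n - m) :: rat) \<noteq> 0" by (simp del: of_nat_diff)
    then have "padic_norm (of_nat (n - m) :: 'a padic) \<noteq> 0"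
      by (simp add: padic_norm_of_nat padic_abs_rat_eq_0_iff[OF prime_card] del: of_nat_diff)
    then have "(of_nat (n - m) :: 'a padic) \<noteq> 0" by (metis padic_norm_eq_0_iff)
    moreover have "of_nat n = of_nat m + (of_nat (n - m) :: 'a padic)"
      using \<open>m < n\<close> by (metis le_add_diff_inverse less_imp_le of_nat_add)
    ultimately show "(of_nat m :: 'a padic) \<noteq> of_nat n" by (simp del: of_nat_diff)
  qed
qed

instance padic :: (prime_card) perfect_space
proof
  fix x :: "'a padic"
  show "\<not> open {x}"
  proof
    assume "open {x}"
    then obtain e where e: "e > 0" "\<And>y. dist y x < e \<Longrightarrow> y = x"
      by (auto simp: open_dist)
    let ?q = "of_nat CARD('a) :: 'a padic"
    have "real CARD('a) > 1" using prime_gt_1_nat[OF prime_card[where 'a='a]] by simp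
    then have q: "padic_norm ?q < 1" "padic_norm ?q > 0" by (auto simp: padic_norm_prime)
    obtain n where n: "padic_norm ?q ^ n < e" using real_arch_pow_inv[OF e(1) q(1)] by blast
    have nm: "padic_norm (?q ^ n) = padic_norm ?q ^ n" by (induction n) (simp_all add: padic_norm_mult padic_norm_1)
    have "dist (x + ?q ^ n) x < e" using n nm by (simp add: dist_padic_def)
    then have "?q ^ n = 0" using e(2) by force
    then show False using q nm padic_norm_eq_0_iff[of "?q ^ n"] by simp
  qed
qed


section \<open>Derivatives and fixed points of the map\<close>

text \<open>
  The library derivative requires a real normed field, so the derivative as the limit of
  difference quotients is spelled out for p-adic functions.
\<close>

definition has_padic_derivative ::
  "('p::prime_card padic \<Rightarrow> 'p padic) \<Rightarrow> 'p padic \<Rightarrow> 'p padic \<Rightarrow> bool" where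
  "has_padic_derivative f D x \<longleftrightarrow> ((\<lambda>h. (f (x + h) - f x) / h) \<longlongrightarrow> D) (at 0)"

lemma has_padic_derivative_unique:
  "has_padic_derivative f D x \<Longrightarrow> has_padic_derivative f D' x \<Longrightarrow> D = D'"
  unfolding has_padic_derivative_def by (rule tendsto_unique[OF at_neq_bot])

definition padic_E :: "'p::prime_card padic set" where
  "padic_E = {x. padic_norm (x - 1) < 1}"

definition g_map :: "'p::prime_card padic \<Rightarrow> 'p padic \<Rightarrow> 'p padic \<Rightarrow> 'p padic" where
  "g_map a b u = a * ((b\<^sup>2 * u\<^sup>2 + 1) / (b\<^sup>2 + u\<^sup>2))"

text \<open>Points where the denominator vanishes are excluded, since division by zero yields zero.\<close>

definition is_fixed_point :: "'p::prime_card padic \<Rightarrow> 'p padic \<Rightarrow> 'p padic \<Rightarrow> bool" where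
  "is_fixed_point a b x \<longleftrightarrow> b\<^sup>2 + x\<^sup>2 \<noteq> 0 \<and> g_map a b x = x"

definition attracting_fixed_point :: "'p::prime_card padic \<Rightarrow> 'p padic \<Rightarrow> 'p padic \<Rightarrow> bool" where
  "attracting_fixed_point a b x \<longleftrightarrow> is_fixed_point a b x \<and>
     (\<exists>D. has_padic_derivative (g_map a b) D x \<and> 0 \<le> padic_norm D \<and> padic_norm D < 1)"

definition repelling_fixed_point :: "'p::prime_card padic \<Rightarrow> 'p padic \<Rightarrow> 'p padic \<Rightarrow> bool" where
  "repelling_fixed_point a b x \<longleftrightarrow> is_fixed_point a b x \<and>
     (\<exists>D. has_padic_derivative (g_map a b) D x \<and> padic_norm D > 1)"

end

theory Submission
  imports Defs
begin

text \<open>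
  Clearing the denominator and using \<open>b\<^sup>2x\<^sup>2 + 1 = b\<^sup>2(b\<^sup>2 + x\<^sup>2) + (1 - b\<^sup>4)\<close>, the fixed
  point equation becomes
    \<open>(b\<^sup>2 + x\<^sup>2)(x - ab\<^sup>2) = a(1 - b\<^sup>4)\<close>,
  and the derivative is \<open>\<lambda> = 2ax(b\<^sup>4 - 1) / (b\<^sup>2 + x\<^sup>2)\<^sup>2\<close>. As \<open>a\<close> and \<open>b\<close> reduce to \<open>1\<close> in the
  residue field, \<open>b\<^sup>4 - 1\<close> is small and \<open>\<bar>a\<bar> = 1\<close>; since the residue characteristic is odd,
  \<open>\<bar>2\<bar> = 1\<close>. So only the size of \<open>b\<^sup>2 + x\<^sup>2\<close> has to be found.

  If \<open>x\<close> reduces to \<open>1\<close>, then \<open>b\<^sup>2 + x\<^sup>2\<close> reduces to \<open>2\<close>, so it is a unit and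
  \<open>\<bar>\<lambda>\<bar> = \<bar>b\<^sup>4 - 1\<bar> < 1\<close>.

  If \<open>x\<close> does not reduce to \<open>1\<close>, the smallness of the right-hand side first forces \<open>\<bar>x\<bar> = 1\<close>.
  Then \<open>x - ab\<^sup>2\<close> is a unit because \<open>ab\<^sup>2\<close> reduces to \<open>1\<close>, so the equation gives
  \<open>\<bar>b\<^sup>2 + x\<^sup>2\<bar> = \<bar>b\<^sup>4 - 1\<bar>\<close>. As the left-hand side is nonzero, \<open>\<bar>\<lambda>\<bar> = 1 / \<bar>b\<^sup>4 - 1\<bar> > 1\<close>.

  It remains to see that only one fixed point reduces to \<open>1\<close>. Modulo the maximal ideal the fixed
  point equation is \<open>(x - 1)(x\<^sup>2 + 1) = 0\<close>, of which \<open>1\<close> is a simple root as \<open>2 \<noteq> 0\<close>.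
\<close>

section \<open>Ultrametric estimates\<close>

lemma padic_norm_diff_max: "padic_norm (x - y) \<le> max (padic_norm x) (padic_norm y)"
  for x y :: "'p::prime_card padic"
  using padic_norm_add_max[of x "- y"] by (simp add: padic_norm_minus)

lemma padic_norm_add_less:
  fixes x y :: "'p::prime_card padic"
  shows "padic_norm x < r \<Longrightarrow> padic_norm y < r \<Longrightarrow> padic_norm (x + y) < r"
  using padic_norm_add_max[of x y] by linarith

lemma padic_norm_diff_less:
  fixes x y :: "'p::prime_card padic"
  shows "padic_norm x < r \<Longrightarrow> padic_norm y < r \<Longrightarrow> padic_norm (x - y) < r"
  using padic_norm_diff_max[of x y] by linarith

lemma padic_norm_diff_commute: "padic_norm (x - y) = padic_norm (y - x)"
  for x y :: "'p::prime_card padic"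
  using padic_norm_minus[of "x - y"] by simp

lemma padic_norm_add_dominant:
  fixes x y :: "'p::prime_card padic"
  assumes "padic_norm y < padic_norm x"
  shows "padic_norm (x + y) = padic_norm x"
  using assms padic_norm_add_max[of x y] padic_norm_diff_max[of "x + y" y] by simp

lemma padic_norm_power: "padic_norm (x ^ n) = padic_norm x ^ n"
  for x :: "'p::prime_card padic"
  by (induction n) (simp_all add: padic_norm_mult padic_norm_1)

lemma padic_norm_divide: "padic_norm (x / y) = padic_norm x / padic_norm y"
  for x y :: "'p::prime_card padic"
proof (cases "y = 0")
  case True
  then show ?thesis using padic_norm_eq_0_iff[of "0 :: 'p padic"] by simp
next
  case False
  then have "padic_norm (x / y) * padic_norm y = padic_norm x"
    by (simp flip: padic_norm_mult)
  then show ?thesis using False padic_norm_eq_0_iff[of y] by (simp add: field_simps)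
qed

lemma padic_norm_two:
  assumes "CARD('p) \<ge> 3"
  shows "padic_norm (2 :: 'p::prime_card padic) = 1"
proof -
  have "\<not> int CARD('p) dvd 2" using assms by (auto dest: zdvd_imp_le)
  then have "multiplicity (int CARD('p)) 2 = 0" by (rule not_dvd_imp_multiplicity_0)
  then have "padic_val_rat CARD('p) 2 = 0" by (simp add: padic_val_rat_def)
  then have "padic_abs_rat CARD('p) 2 = 1" by (simp add: padic_abs_rat_def)
  then show ?thesis using padic_norm_of_nat[of 2, where 'p='p] by simp
qed


section \<open>The group of principal units\<close>

lemma padic_E_norm:
  assumes "x \<in> padic_E"
  shows "padic_norm x = 1"
  using padic_norm_add_dominant[of "x - 1" 1] assms by (simp add: padic_E_def padic_norm_1)

lemma padic_E_mult:
  assumes "x \<in> padic_E" "y \<in> padic_E"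
  shows "x * y \<in> padic_E"
proof -
  have "padic_norm (x * (y - 1)) < 1" "padic_norm (x - 1) < 1"
    using assms padic_E_norm[OF assms(1)] by (simp_all add: padic_E_def padic_norm_mult)
  then have "padic_norm (x * (y - 1) + (x - 1)) < 1" by (rule padic_norm_add_less)
  moreover have "x * (y - 1) + (x - 1) = x * y - 1" by (simp add: algebra_simps)
  ultimately show ?thesis by (simp add: padic_E_def)
qed

lemma padic_E_one: "(1 :: 'p::prime_card padic) \<in> padic_E"
  using padic_norm_eq_0_iff[of "0 :: 'p padic"] by (simp add: padic_E_def)

lemma padic_E_power: "x \<in> padic_E \<Longrightarrow> x ^ n \<in> padic_E"
  by (induction n) (simp_all add: padic_E_one padic_E_mult)

lemma padic_E_diff_norm:
  assumes "x \<in> padic_E" "y \<in> padic_E"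
  shows "padic_norm (x - y) < 1"
  using padic_norm_diff_less[of "x - 1" 1 "y - 1"] assms by (simp add: padic_E_def)

lemma padic_E_sum_norm:
  assumes "CARD('p) \<ge> 3" "x \<in> padic_E" "y \<in> padic_E"
  shows "padic_norm (x + y :: 'p::prime_card padic) = 1"
proof -
  have "padic_norm ((x - 1) + (y - 1)) < padic_norm (2 :: 'p padic)"
    unfolding padic_norm_two[OF assms(1)]
    using assms by (intro padic_norm_add_less) (simp_all add: padic_E_def)
  from padic_norm_add_dominant[OF this] show ?thesis
    by (simp add: padic_norm_two[OF assms(1)])
qed


section \<open>The derivative of the map\<close>

text \<open>
  A linear bound on the error of the difference quotient is used, since it can be checked by
  algebra alone.
\<close>

lemma has_padic_derivativeI_bound:
  fixes x :: "'p::prime_card padic"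
  assumes "r > 0"
    and "\<And>h. h \<noteq> 0 \<Longrightarrow> padic_norm h < r \<Longrightarrow>
           padic_norm ((f (x + h) - f x) / h - D) \<le> K * padic_norm h"
  shows "has_padic_derivative f D x"
  unfolding has_padic_derivative_def
proof (subst tendsto_dist_iff, rule tendsto_sandwich)
  let ?q = "\<lambda>h. (f (x + h) - f x) / h"
  show "\<forall>\<^sub>F h in at 0. 0 \<le> dist (?q h) D" by simp
  show "\<forall>\<^sub>F h in at 0. dist (?q h) D \<le> K * dist h 0"
    unfolding eventually_at using assms by (auto simp: dist_padic_def)
  have "((\<lambda>h :: 'p padic. dist h 0) \<longlongrightarrow> 0) (at 0)"
    by (rule tendsto_dist_iff[THEN iffD1]) (rule tendsto_ident_at)
  from tendsto_mult_right_zero[OF this, of K]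
  show "((\<lambda>h :: 'p padic. K * dist h 0) \<longlongrightarrow> 0) (at 0)" .
qed simp

text \<open>
  Up to the constant \<open>ab\<^sup>2\<close>, the map is \<open>a(1 - b\<^sup>4) / (b\<^sup>2 + u\<^sup>2)\<close>. For small \<open>h\<close> the ultrametric
  inequality makes \<open>b\<^sup>2 + (x + h)\<^sup>2\<close> exactly as large as \<open>b\<^sup>2 + x\<^sup>2\<close>, so that the error of the
  difference quotient is linear in \<open>h\<close>.
\<close>

lemma g_map_has_derivative:
  fixes a b x :: "'p::prime_card padic"
  assumes nz: "b\<^sup>2 + x\<^sup>2 \<noteq> 0"
  shows "has_padic_derivative (g_map a b) (2 * a * x * (b ^ 4 - 1) / (b\<^sup>2 + x\<^sup>2)\<^sup>2) x"
proof -
  define d c where "d = b\<^sup>2 + x\<^sup>2" and "c = a * (b ^ 4 - 1)"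
  define M where "M = max (padic_norm (2 * x)) 1"
  define N where "N = max (padic_norm (d - 4 * x\<^sup>2)) (padic_norm (2 * x))"
  \<comment> \<open>For \<open>\<bar>h\<bar> < r\<close> the increment \<open>(2x + h)h\<close> of the denominator is smaller than \<open>d\<close>.\<close>
  define r where "r = min 1 (padic_norm d / M)"
  have M: "M > 0" by (simp add: M_def)
  have d: "d \<noteq> 0" "padic_norm d > 0"
    using nz padic_norm_nonneg[of d] padic_norm_eq_0_iff[of d] by (auto simp: d_def)
  show ?thesis
  proof (rule has_padic_derivativeI_bound)
    show "r > 0" using d M by (simp add: r_def)
    fix h :: "'p padic" assume h: "h \<noteq> 0" "padic_norm h < r"
    define e where "e = d + (2 * x + h) * h"
    have h1: "padic_norm h < 1" and hM: "padic_norm h * M < padic_norm d"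
      using h(2) M by (simp_all add: r_def field_simps)
    have "padic_norm (2 * x + h) \<le> M"
      using padic_norm_add_max[of "2 * x" h] h1 by (simp add: M_def)
    then have "padic_norm ((2 * x + h) * h) \<le> M * padic_norm h"
      unfolding padic_norm_mult by (rule mult_right_mono) (rule padic_norm_nonneg)
    then have ne: "padic_norm e = padic_norm d"
      unfolding e_def using hM by (intro padic_norm_add_dominant) (simp add: mult.commute)
    have e: "e \<noteq> 0" using ne d padic_norm_eq_0_iff[of e] by auto
    have eq: "b\<^sup>2 + (x + h)\<^sup>2 = e" by (simp add: e_def d_def power2_eq_square algebra_simps)
    have g: "g_map a b u = a * b\<^sup>2 - c / (b\<^sup>2 + u\<^sup>2)" if "b\<^sup>2 + u\<^sup>2 \<noteq> 0" for u
    proof -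
      have "b\<^sup>2 * u\<^sup>2 + 1 = b\<^sup>2 * (b\<^sup>2 + u\<^sup>2) - (b ^ 4 - 1)"
        by (simp add: algebra_simps power2_eq_square power4_eq_xxxx)
      moreover have "A * ((B * E - C) / E) = A * B - A * C / E" if "E \<noteq> 0" for A B C E :: "'p padic"
        using that by (simp add: field_simps)
      ultimately show ?thesis using that by (simp only: g_map_def c_def not_False_eq_True)
    qed
    have "g_map a b (x + h) - g_map a b x = c / d - c / e"
      using g[of x] g[of "x + h"] e d(1) unfolding eq d_def[symmetric] by simp
    also have "\<dots> = c * (e - d) / (d * e)"
      using d(1) e by (simp add: field_simps)
    also have "c * (e - d) = c * (2 * x + h) * h" by (simp add: e_def)
    finally have "(g_map a b (x + h) - g_map a b x) / h = c * (2 * x + h) / (d * e)"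
      using h(1) by simp
    then have "(g_map a b (x + h) - g_map a b x) / h - 2 * a * x * (b ^ 4 - 1) / (b\<^sup>2 + x\<^sup>2)\<^sup>2
        = c * (2 * x + h) / (d * e) - c * (2 * x) / d\<^sup>2"
      by (simp add: c_def d_def mult_ac)
    also have "c * s / (d * e) - c * t / d\<^sup>2 = c * (s * d - t * e) / (d\<^sup>2 * e)" for s t
      using d(1) e by (simp add: field_simps power2_eq_square)
    also have "(2 * x + h) * d - 2 * x * e = h * ((d - 4 * x\<^sup>2) - 2 * x * h)"
      by (simp add: e_def power2_eq_square algebra_simps)
    finally have err: "padic_norm ((g_map a b (x + h) - g_map a b x) / h
          - 2 * a * x * (b ^ 4 - 1) / (b\<^sup>2 + x\<^sup>2)\<^sup>2)
        = padic_norm c * padic_norm h * padic_norm ((d - 4 * x\<^sup>2) - 2 * x * h) / padic_norm d ^ 3"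
      by (simp add: padic_norm_divide padic_norm_mult padic_norm_power ne
          power2_eq_square power3_eq_cube)
    have "padic_norm (2 * x) * padic_norm h \<le> padic_norm (2 * x) * 1"
      using h1 by (intro mult_left_mono) (auto simp: padic_norm_nonneg)
    then have "padic_norm ((d - 4 * x\<^sup>2) - 2 * x * h) \<le> N"
      using padic_norm_diff_max[of "d - 4 * x\<^sup>2" "2 * x * h"] padic_norm_mult[of "2 * x" h]
      by (simp add: N_def)
    then have "padic_norm c * padic_norm h * padic_norm ((d - 4 * x\<^sup>2) - 2 * x * h) / padic_norm d ^ 3
        \<le> padic_norm c * padic_norm h * N / padic_norm d ^ 3"
      using d(2) by (intro divide_right_mono mult_left_mono) (simp_all add: padic_norm_nonneg)
    then show "padic_norm ((g_map a b (x + h) - g_map a b x) / h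
          - 2 * a * x * (b ^ 4 - 1) / (b\<^sup>2 + x\<^sup>2)\<^sup>2)
        \<le> (padic_norm c * N / padic_norm d ^ 3) * padic_norm h"
      unfolding err by (simp add: mult_ac)
  qed
qed


section \<open>The fixed points and their multipliers\<close>

lemma fixed_point_equation:
  assumes "is_fixed_point a b x"
  shows "x * (b\<^sup>2 + x\<^sup>2) = a * (b\<^sup>2 * x\<^sup>2 + 1)"
proof -
  let ?d = "b\<^sup>2 + x\<^sup>2" and ?n = "b\<^sup>2 * x\<^sup>2 + 1"
  have nz: "?d \<noteq> 0" and fixed: "g_map a b x = x"
    using assms unfolding is_fixed_point_def by blast+
  have "g_map a b x * ?d = a * (?n / ?d * ?d)" unfolding g_map_def by (rule mult.assoc)
  also have "?n / ?d * ?d = ?n" using nz by simp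
  finally show ?thesis unfolding fixed .
qed

text \<open>
  The difference of the two fixed point equations is \<open>x - y\<close> times the factor \<open>q\<close> below, and \<open>q\<close>
  reduces to \<open>2\<close>, the value at \<open>1\<close> of the derivative of the reduced cubic.
\<close>

lemma fixed_point_in_E_unique:
  fixes a b x y :: "'p::prime_card padic"
  assumes p: "CARD('p) \<ge> 3" and a: "a \<in> padic_E" and b: "b \<in> padic_E"
    and x: "is_fixed_point a b x" "x \<in> padic_E" and y: "is_fixed_point a b y" "y \<in> padic_E"
  shows "x = y"
proof -
  define q where "q = (x\<^sup>2 + b\<^sup>2) + ((x * y - a * b\<^sup>2 * x) + (y\<^sup>2 - a * b\<^sup>2 * y))"
  have "padic_norm ((x * y - a * b\<^sup>2 * x) + (y\<^sup>2 - a * b\<^sup>2 * y)) < padic_norm (x\<^sup>2 + b\<^sup>2)"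
    using padic_E_sum_norm[OF p, of "x\<^sup>2" "b\<^sup>2"] a b x(2) y(2)
    by (simp add: padic_norm_add_less padic_E_diff_norm padic_E_mult padic_E_power)
  then have "padic_norm q = padic_norm (x\<^sup>2 + b\<^sup>2)"
    unfolding q_def by (rule padic_norm_add_dominant)
  then have "padic_norm q = 1"
    using padic_E_sum_norm[OF p, of "x\<^sup>2" "b\<^sup>2"] x(2) b by (simp add: padic_E_power)
  then have "q \<noteq> 0" using padic_norm_eq_0_iff[of q] by auto
  have "(x - y) * q = (x * (b\<^sup>2 + x\<^sup>2) - a * (b\<^sup>2 * x\<^sup>2 + 1)) - (y * (b\<^sup>2 + y\<^sup>2) - a * (b\<^sup>2 * y\<^sup>2 + 1))"
    by (simp add: q_def algebra_simps power2_eq_square)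
  then have "(x - y) * q = 0"
    using fixed_point_equation[OF x(1)] fixed_point_equation[OF y(1)] by simp
  with \<open>q \<noteq> 0\<close> show ?thesis by simp
qed

lemma multiplier_norm:
  fixes a b x :: "'p::prime_card padic"
  assumes "CARD('p) \<ge> 3" "a \<in> padic_E"
  shows "padic_norm (2 * a * x * (b ^ 4 - 1) / (b\<^sup>2 + x\<^sup>2)\<^sup>2)
    = padic_norm x * padic_norm (b ^ 4 - 1) / (padic_norm (b\<^sup>2 + x\<^sup>2))\<^sup>2"
  using assms
  by (simp add: padic_norm_divide padic_norm_mult padic_norm_power padic_norm_two padic_E_norm)

lemma fixed_point_in_E_attracting:
  fixes a b x :: "'p::prime_card padic"
  assumes p: "CARD('p) \<ge> 3" and a: "a \<in> padic_E" and b: "b \<in> padic_E"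
    and x: "is_fixed_point a b x" "x \<in> padic_E"
  shows "attracting_fixed_point a b x"
proof -
  let ?D = "2 * a * x * (b ^ 4 - 1) / (b\<^sup>2 + x\<^sup>2)\<^sup>2"
  have "padic_norm (b\<^sup>2 + x\<^sup>2) = 1" "padic_norm (b ^ 4 - 1) < 1"
    using padic_E_sum_norm[OF p, of "b\<^sup>2" "x\<^sup>2"] padic_E_diff_norm[OF _ padic_E_one, of "b ^ 4"] b x(2)
    by (simp_all add: padic_E_power)
  then have "padic_norm ?D < 1"
    using multiplier_norm[OF p a] padic_E_norm[OF x(2)] by simp
  moreover have "has_padic_derivative (g_map a b) ?D x"
    using x(1) by (intro g_map_has_derivative) (simp add: is_fixed_point_def)
  ultimately show ?thesis
    unfolding attracting_fixed_point_def using x(1) padic_norm_nonneg by blast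
qed

text \<open>
  Outside \<open>padic_E\<close> the factor \<open>x - ab\<^sup>2\<close> of the fixed point equation cannot be small, so all the
  smallness of \<open>b\<^sup>4 - 1\<close> sits in \<open>b\<^sup>2 + x\<^sup>2\<close>.
\<close>

lemma fixed_point_outside_E_norms:
  fixes a b x :: "'p::prime_card padic"
  assumes a: "a \<in> padic_E" and b: "b \<in> padic_E"
    and x: "is_fixed_point a b x" "x \<notin> padic_E"
  shows "padic_norm x = 1" and "padic_norm (b\<^sup>2 + x\<^sup>2) = padic_norm (b ^ 4 - 1)"
proof -
  have ab: "a * b\<^sup>2 \<in> padic_E" using a b by (simp add: padic_E_mult padic_E_power)
  have b2: "padic_norm (b\<^sup>2) = 1" using b by (simp add: padic_E_norm padic_E_power)
  have small: "padic_norm (b ^ 4 - 1) < 1" using padic_E_power[OF b, of 4] by (simp add: padic_E_def)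
  have "(b\<^sup>2 + x\<^sup>2) * (x - a * b\<^sup>2) = x * (b\<^sup>2 + x\<^sup>2) - a * b\<^sup>2 * (b\<^sup>2 + x\<^sup>2)"
    by (simp add: algebra_simps)
  also have "\<dots> = a * (b\<^sup>2 * x\<^sup>2 + 1) - a * b\<^sup>2 * (b\<^sup>2 + x\<^sup>2)"
    by (simp only: fixed_point_equation[OF x(1)])
  also have "\<dots> = a * (1 - b ^ 4)"
    by (simp add: algebra_simps power2_eq_square power4_eq_xxxx)
  finally have prod: "padic_norm (b\<^sup>2 + x\<^sup>2) * padic_norm (x - a * b\<^sup>2) = padic_norm (b ^ 4 - 1)"
    using padic_norm_mult[of "b\<^sup>2 + x\<^sup>2" "x - a * b\<^sup>2"] padic_norm_mult[of a "1 - b ^ 4"]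
      padic_E_norm[OF a] padic_norm_diff_commute[of 1 "b ^ 4"] by simp
  show nx: "padic_norm x = 1"
  proof (rule ccontr)
    assume "padic_norm x \<noteq> 1"
    then consider "padic_norm x < 1" | "padic_norm x > 1" by linarith
    then show False
    proof cases
      case 1
      then have "padic_norm (b\<^sup>2 + x\<^sup>2) = 1"
        using padic_norm_add_dominant[of "x\<^sup>2" "b\<^sup>2"] b2 padic_norm_nonneg[of x]
        by (simp add: padic_norm_power power_less_one_iff)
      moreover have "padic_norm (x - a * b\<^sup>2) = 1"
        using padic_norm_add_dominant[of x "- (a * b\<^sup>2)"] 1 padic_E_norm[OF ab]
        by (simp add: padic_norm_minus)
      ultimately show False using prod small by simp
    next
      case 2
      then have x2: "1 < (padic_norm x)\<^sup>2" by simp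
      then have "padic_norm (b\<^sup>2 + x\<^sup>2) = (padic_norm x)\<^sup>2"
        using padic_norm_add_dominant[of "b\<^sup>2" "x\<^sup>2"] b2 by (simp add: padic_norm_power add.commute)
      moreover have "padic_norm (x - a * b\<^sup>2) = padic_norm x"
        using padic_norm_add_dominant[of "- (a * b\<^sup>2)" x] 2 padic_E_norm[OF ab]
        by (simp add: padic_norm_minus)
      moreover have "1 < (padic_norm x)\<^sup>2 * padic_norm x"
        using x2 2 by (intro less_1_mult)
      ultimately show False using prod small by simp
    qed
  qed
  have "padic_norm (x - a * b\<^sup>2) = 1"
  proof (rule antisym)
    show "padic_norm (x - a * b\<^sup>2) \<le> 1"
      using padic_norm_diff_max[of x "a * b\<^sup>2"] nx padic_E_norm[OF ab] by simp
    show "1 \<le> padic_norm (x - a * b\<^sup>2)"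
    proof (rule ccontr)
      assume "\<not> 1 \<le> padic_norm (x - a * b\<^sup>2)"
      then have "padic_norm ((x - a * b\<^sup>2) + (a * b\<^sup>2 - 1)) < 1"
        using ab by (intro padic_norm_add_less) (simp_all add: padic_E_def)
      then show False using x(2) by (simp add: padic_E_def)
    qed
  qed
  then show "padic_norm (b\<^sup>2 + x\<^sup>2) = padic_norm (b ^ 4 - 1)" using prod by simp
qed

lemma fixed_point_outside_E_repelling:
  fixes a b x :: "'p::prime_card padic"
  assumes p: "CARD('p) \<ge> 3" and a: "a \<in> padic_E" and b: "b \<in> padic_E"
    and x: "is_fixed_point a b x" "x \<notin> padic_E"
  shows "repelling_fixed_point a b x"
proof -
  let ?D = "2 * a * x * (b ^ 4 - 1) / (b\<^sup>2 + x\<^sup>2)\<^sup>2"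
  let ?s = "padic_norm (b ^ 4 - 1)"
  have nz: "b\<^sup>2 + x\<^sup>2 \<noteq> 0" using x(1) by (simp add: is_fixed_point_def)
  have "?s < 1" using padic_E_power[OF b, of 4] by (simp add: padic_E_def)
  moreover have "?s > 0"
    using fixed_point_outside_E_norms(2)[OF a b x] nz padic_norm_eq_0_iff[of "b\<^sup>2 + x\<^sup>2"]
      padic_norm_nonneg[of "b\<^sup>2 + x\<^sup>2"] by linarith
  moreover have "padic_norm ?D = 1 / ?s"
    unfolding multiplier_norm[OF p a] fixed_point_outside_E_norms[OF a b x]
    by (simp add: power2_eq_square)
  ultimately have "padic_norm ?D > 1" by simp
  then show ?thesis
    unfolding repelling_fixed_point_def using x(1) g_map_has_derivative[OF nz] by blast
qed

theorem theorem4p1: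
  fixes a b x0 x1 x2 :: "'p::prime_card padic"
  assumes "CARD('p) \<ge> 3"
    and "a \<in> padic_E" and "b \<in> padic_E"
    and "distinct [x0, x1, x2]"
    and "{x. is_fixed_point a b x} = {x0, x1, x2}"
    and "x0 \<in> padic_E"
  shows "attracting_fixed_point a b x0
    \<and> repelling_fixed_point a b x1 \<and> repelling_fixed_point a b x2"
proof -
  have fixed: "is_fixed_point a b x0" "is_fixed_point a b x1" "is_fixed_point a b x2"
    using assms(5) by auto
  have "x1 \<notin> padic_E" "x2 \<notin> padic_E"
    using fixed_point_in_E_unique[OF assms(1-3) fixed(1) assms(6)] fixed assms(4) by auto
  then show ?thesis
    using fixed_point_in_E_attracting[OF assms(1-3) fixed(1) assms(6)]
      fixed_point_outside_E_repelling[OF assms(1-3)] fixed by blast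
qed

end
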